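(* Let $N > 0$ and $0 \leqslant n_0 < n_1 < \cdots < n_{N-1}$ be integers, and for each integer $M > n_{N-1}$, let $\epsilon_M \in \{-1,0,+1\}$ be a sign. Let $0 < \rho < +\infty$, and let $c_{n_0},\dots,c_{n_{N-1}}$ be positive reals. Then there exists a convergent power series $$f(x) = c_{n_0} x^{n_0} + c_{n_1} x^{n_1} + \dots + c_{n_{N-1}} x^{n_{N-1}} + \sum_{M > n_{N-1}} c_M x^M$$ on $(0,\rho)$ (with real coefficients) that is an entrywise positivity preserver on $\mathbb{P}_N((0,\rho))$, such that for each integer $M > n_{N-1}$, $c_M$ has the sign of $\epsilon_M$ (that is, $c_M$ is negative, zero, or positive according as $\epsilon_M = -1, 0, +1$).
   Context: For $I \subset \mathbb{C}$, $\mathbb{P}_N(I)$ denotes the set of positive semidefinite Hermitian $N\times N$ matrices all of whose entries lie in $I$. For a function $f$ on $I$ and a matrix $A=(a_{jk})$ with entries in $I$, $f[A] := (f(a_{jk}))$ is the entrywise application of $f$. The function $f$ is an entrywise positivity preserver on $\mathbb{P}_N(I)$ if $f[A]$ is positive semidefinite for every $A \in \mathbb{P}_N(I)$. *)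

theory Defs
  imports "Jordan_Normal_Form.Schur_Decomposition"
begin

definition hermitian_mat :: "complex mat \<Rightarrow> bool" where
  "hermitian_mat A \<longleftrightarrow> mat_adjoint A = A"

text \<open>\<open>mat_adjoint A = A\<close> already forces \<open>A\<close> to be square.\<close>

definition psd_mat :: "complex mat \<Rightarrow> bool" where
  "psd_mat A \<longleftrightarrow> hermitian_mat A \<and>
     (\<forall>v \<in> carrier_vec (dim_row A). Re ((A *\<^sub>v v) \<bullet>c v) \<ge> 0)"

definition psd_mats_on :: "nat \<Rightarrow> complex set \<Rightarrow> complex mat set" where
  "psd_mats_on N I = {A \<in> carrier_mat N N. psd_mat A \<and> elements_mat A \<subseteq> I}"

text \<open>A function on \<open>I\<close> is represented by a total function; only its values on \<open>I\<close> matter here.\<close>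

definition entrywise_positivity_preserver ::
    "(complex \<Rightarrow> complex) \<Rightarrow> nat \<Rightarrow> complex set \<Rightarrow> bool" where
  "entrywise_positivity_preserver f N I \<longleftrightarrow> (\<forall>A \<in> psd_mats_on N I. psd_mat (map_mat f A))"

end

theory Submission
  imports Defs "HOL-Analysis.Convex"
begin

text \<open>
  Write \<open>h(x) = \<Sum>\<^sub>j a\<^sub>j x^(n\<^sub>j)\<close> for the prescribed positive part. Applied entrywise, \<open>h\<close> and all
  monomials preserve positive semidefiniteness by the Schur product theorem. So everything rests on
  absorbing a negative higher power: for every \<open>M\<close> beyond the \<open>n\<^sub>j\<close> there is a constant \<open>K\<^sub>M\<close> such
  that \<open>K\<^sub>M h[A] - x^M[A]\<close> is positive semidefinite for all admissible \<open>A\<close>, uniformly in \<open>A\<close>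
  (\<open>power_dominated_by_lower_powers\<close>). Given this, coefficients \<open>\<epsilon>\<^sub>M \<delta>\<^sub>M\<close> with
  \<open>\<Sum> \<delta>\<^sub>M K\<^sub>M \<le> 1\<close> lose at most one copy of \<open>h[A]\<close> altogether, whatever the signs are.

  The domination is proved by induction on the dimension, with two ingredients.

  Rank one, \<open>A = u u\<^sup>T\<close>: as there are as many exponents \<open>n\<^sub>j\<close> as coordinates \<open>u\<^sub>i\<close>, one can
  interpolate \<open>u\<^sub>i^M = \<Sum>\<^sub>j b\<^sub>j u\<^sub>i^(n\<^sub>j)\<close>. The point is that the \<open>b\<^sub>j\<close> are bounded independently of
  \<open>u\<close>, however close its coordinates are: \<open>x^M - \<Sum>\<^sub>j b\<^sub>j x^(n\<^sub>j)\<close> has the maximal number of zeros in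
  the interval, and dividing by the lowest power and differentiating yields, by Rolle's theorem, a
  shorter polynomial of the same kind (\<open>exists_leading_coeff_bound\<close>). This replaces the usual
  estimate for ratios of Schur polynomials. Cauchy--Schwarz then finishes the rank one case.

  Higher rank (FitzGerald and Horn): on the segment from \<open>B = \<zeta> \<zeta>\<^sup>T\<close> to \<open>A\<close>, where \<open>\<zeta>\<close> is the
  normalised last column of \<open>A\<close>, the quadratic form of \<open>f[B + t (A - B)]\<close> has \<open>t\<close>-derivative given
  by the Schur product of \<open>A - B\<close> with \<open>f'[B + t (A - B)]\<close>. As \<open>A - B\<close> is positive semidefinite
  with zero last row and column, only the leading block of \<open>f'[\<dots>]\<close>, one dimension lower, matters. For
  \<open>f = K h - x^M\<close> this \<open>f'\<close> is again of the same form, with all exponents lowered by one.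
\<close>

section \<open>Sparse polynomials with the maximal number of positive zeros\<close>

lemma rolle_many_zeros:
  fixes g g' :: "real \<Rightarrow> real"
  assumes fin: "finite S" and ne: "S \<noteq> {}"
    and deriv: "\<And>x. (g has_real_derivative g' x) (at x)"
    and zero: "\<And>s. s \<in> S \<Longrightarrow> g s = 0"
  shows "\<exists>T. finite T \<and> Suc (card T) = card S \<and> T \<subseteq> {Min S..Max S} \<and> (\<forall>t\<in>T. g' t = 0)"
  using fin ne zero
proof (induction S rule: finite_linorder_max_induct)
  case empty
  then show ?case by simp
next
  case (insert b A)
  show ?case
  proof (cases "A = {}")
    case True
    then show ?thesis by (intro exI[of _ "{}"]) auto
  next
    case False
    with insert obtain T where T: "finite T" "Suc (card T) = card A"
      "T \<subseteq> {Min A..Max A}" "\<forall>t\<in>T. g' t = 0" by auto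
    have lt: "Max A < b" using insert False by simp
    have cont: "continuous_on {Max A..b} g"
      using deriv DERIV_isCont continuous_at_imp_continuous_on by blast
    have "\<exists>z. Max A < z \<and> z < b \<and> DERIV g z :> 0"
    proof (rule Rolle[OF lt _ cont])
      show "g (Max A) = g b" using insert.prems False insert.hyps by simp
      show "\<And>x. Max A < x \<Longrightarrow> x < b \<Longrightarrow> g differentiable (at x)"
        using deriv real_differentiable_def by blast
    qed
    then obtain z where z: "Max A < z" "z < b" "DERIV g z :> 0" by blast
    have z0: "g' z = 0" using z(3) deriv DERIV_unique by blast
    have zT: "z \<notin> T" using T(3) z(1) by fastforce
    have bA: "b \<notin> A" using insert by auto
    have Max: "Max (insert b A) = b"
      using insert.hyps by (intro Max_eqI) (auto intro: less_imp_le)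
    have "Min A < b" using insert.hyps False Min_in by blast
    then have Min: "Min (insert b A) = Min A"
      using False insert.hyps(1) by (intro Min_eqI) auto
    have mm: "Min A \<le> Max A" using False insert.hyps by simp
    show ?thesis
    proof (intro exI[of _ "insert z T"] conjI)
      show "Suc (card (insert z T)) = card (insert b A)"
        using T zT bA insert.hyps by simp
      show "insert z T \<subseteq> {Min (insert b A)..Max (insert b A)}"
        unfolding Max Min using T(3) z lt mm by fastforce
    qed (use T z0 in auto)
  qed
qed

text \<open>
  A polynomial with exponents \<open>n 0 < \<dots> < n N\<close> has at most \<open>N\<close> positive zeros unless it vanishes, and
  \<open>C\<close> quantifies this: if \<open>N\<close> zeros in \<open>(0, r)\<close> occur, the leading coefficient controls all the
  others. Taking the leading coefficient to be zero gives back the bound on the number of zeros.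
\<close>
definition leading_coeff_dominates :: "nat \<Rightarrow> (nat \<Rightarrow> nat) \<Rightarrow> real \<Rightarrow> real \<Rightarrow> bool" where
  "leading_coeff_dominates N n r C \<longleftrightarrow>
     (\<forall>b S. finite S \<and> card S = N \<and> S \<subseteq> {0<..<r} \<and> (\<forall>t\<in>S. (\<Sum>j\<le>N. b j * t ^ n j) = 0)
        \<longrightarrow> (\<forall>j\<le>N. \<bar>b j\<bar> \<le> C * \<bar>b N\<bar>))"

lemma leading_coeff_dominatesD:
  assumes "leading_coeff_dominates N n r C" and "finite S" and "card S = N" and "S \<subseteq> {0<..<r}"
    and "\<And>t. t \<in> S \<Longrightarrow> (\<Sum>j\<le>N. b j * t ^ n j) = 0" and "j \<le> N"
  shows "\<bar>b j\<bar> \<le> C * \<bar>b N\<bar>"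
  using assms(1)[unfolded leading_coeff_dominates_def, rule_format, of S b j] assms(2-) by simp

text \<open>
  The existence of one constant for all positions of the zeros is what makes the domination below
  uniform. Dividing by \<open>t ^ n 0\<close> and differentiating removes one term and, by Rolle, one zero, which
  bounds all coefficients but the lowest; the equation at any single zero then bounds that one.
\<close>
lemma exists_leading_coeff_bound:
  fixes n :: "nat \<Rightarrow> nat" and r :: real
  assumes "strict_mono_on {..N} n" and "r > 0"
  shows "\<exists>C\<ge>0. leading_coeff_dominates N n r C"
  using assms(1)
proof (induction N arbitrary: n)
  case 0
  show ?case by (intro exI[of _ 1]) (auto simp: leading_coeff_dominates_def)
next
  case (Suc N)
  define d where "d j = n (Suc j) - n 0" for j
  have n0: "n 0 < n (Suc j)" if "j \<le> N" for j
    using Suc.prems that by (auto simp: strict_mono_on_def)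
  have mono: "strict_mono_on {..N} (\<lambda>j. d j - 1)"
  proof (rule strict_mono_onI)
    fix i j assume ij: "i \<in> {..N}" "j \<in> {..N}" "i < j"
    then have "n (Suc i) < n (Suc j)" using Suc.prems by (auto simp: strict_mono_on_def)
    then show "d i - 1 < d j - 1" using n0[of i] n0[of j] ij by (auto simp: d_def)
  qed
  obtain C where C0: "C \<ge> 0" and C: "leading_coeff_dominates N (\<lambda>j. d j - 1) r C"
    using Suc.IH[OF mono] by blast
  \<comment> \<open>\<open>C1\<close> bounds the coefficients that survive differentiation, where the factor \<open>d N\<close> comes from the
    leading term; \<open>C2\<close> bounds the lowest coefficient.\<close>
  define C1 where "C1 = C * real (d N)"
  define C2 where "C2 = (\<Sum>j\<le>N. C1 * r ^ d j)"
  have C10: "C1 \<ge> 0" using C0 by (simp add: C1_def)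
  have C20: "C2 \<ge> 0" unfolding C2_def using C10 assms(2) by (intro sum_nonneg) auto
  have "leading_coeff_dominates (Suc N) n r (C1 + C2)"
    unfolding leading_coeff_dominates_def
  proof (intro allI impI, elim conjE)
    fix b S j
    assume S: "finite S" "card S = Suc N" "S \<subseteq> {0<..<r}"
      and z: "\<forall>t\<in>S. (\<Sum>j\<le>Suc N. b j * t ^ n j) = 0" and j: "j \<le> Suc N"
    define g where "g t = b 0 + (\<Sum>j\<le>N. b (Suc j) * t ^ d j)" for t :: real
    define g' where "g' t = (\<Sum>j\<le>N. (b (Suc j) * real (d j)) * t ^ (d j - 1))" for t :: real
    have der: "(g has_real_derivative g' t) (at t)" for t
      unfolding g_def g'_def
      by (auto intro!: derivative_eq_intros sum.cong simp: mult_ac)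
    have fact: "(\<Sum>j\<le>Suc N. b j * t ^ n j) = t ^ n 0 * g t" for t :: real
    proof -
      have "t ^ n (Suc j) = t ^ n 0 * t ^ d j" if "j \<le> N" for j
        using n0[OF that] by (simp add: d_def flip: power_add)
      then show ?thesis
        unfolding g_def sum.atMost_Suc_shift by (simp add: algebra_simps sum_distrib_left)
    qed
    have g0: "g t = 0" if "t \<in> S" for t
    proof -
      have "t ^ n 0 \<noteq> 0" using that S(3) by auto
      then show ?thesis using z that unfolding fact by auto
    qed
    have ne: "S \<noteq> {}" using S by auto
    obtain T where T: "finite T" "card T = N" "T \<subseteq> {Min S..Max S}" "\<forall>t\<in>T. g' t = 0"
      using rolle_many_zeros[OF S(1) ne der g0] S(2) by auto
    have "Min S \<in> {0<..<r}" "Max S \<in> {0<..<r}" using S ne Min_in Max_in by blast+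
    then have Tr: "T \<subseteq> {0<..<r}" using T(3) by auto
    have high: "\<bar>b (Suc i)\<bar> \<le> C1 * \<bar>b (Suc N)\<bar>" if i: "i \<le> N" for i
    proof -
      have "1 \<le> real (d i)" using n0[OF i] by (simp add: d_def)
      then have "\<bar>b (Suc i)\<bar> * 1 \<le> \<bar>b (Suc i)\<bar> * real (d i)" by (intro mult_left_mono) auto
      then have "\<bar>b (Suc i)\<bar> \<le> \<bar>b (Suc i) * real (d i)\<bar>" by (simp add: abs_mult)
      also have "\<dots> \<le> C * \<bar>b (Suc N) * real (d N)\<bar>"
        using leading_coeff_dominatesD[OF C T(1,2) Tr _ i, of "\<lambda>j. b (Suc j) * real (d j)"] T(4)
        by (simp add: g'_def)
      finally show ?thesis by (simp add: C1_def abs_mult mult_ac)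
    qed
    have low: "\<bar>b 0\<bar> \<le> C2 * \<bar>b (Suc N)\<bar>"
    proof -
      obtain t where t: "t \<in> S" using ne by blast
      have tr: "0 < t" "t < r" using t S(3) by auto
      have "b 0 = - (\<Sum>j\<le>N. b (Suc j) * t ^ d j)" using g0[OF t] by (simp add: g_def)
      then have "\<bar>b 0\<bar> \<le> (\<Sum>j\<le>N. \<bar>b (Suc j) * t ^ d j\<bar>)" by (simp add: sum_abs)
      also have "\<dots> \<le> (\<Sum>j\<le>N. (C1 * \<bar>b (Suc N)\<bar>) * r ^ d j)"
        unfolding abs_mult using tr C10 high
        by (intro sum_mono mult_mono) (auto intro!: power_mono)
      finally show ?thesis by (simp add: C2_def sum_distrib_left sum_distrib_right mult_ac)
    qed
    show "\<bar>b j\<bar> \<le> (C1 + C2) * \<bar>b (Suc N)\<bar>"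
    proof (cases j)
      case 0
      have "C2 * \<bar>b (Suc N)\<bar> \<le> (C1 + C2) * \<bar>b (Suc N)\<bar>" using C10 by (simp add: mult_right_mono)
      with low 0 show ?thesis by simp
    next
      case (Suc i)
      have "C1 * \<bar>b (Suc N)\<bar> \<le> (C1 + C2) * \<bar>b (Suc N)\<bar>" using C20 by (simp add: mult_right_mono)
      with high[of i] Suc j show ?thesis by simp
    qed
  qed
  then show ?case using C10 C20 by (intro exI[of _ "C1 + C2"]) auto
qed

text \<open>
  Newton-style interpolation: from two such polynomials on the points without \<open>s\<close>, one with and one
  without the top exponent, a combination vanishing at \<open>s\<close> as well is formed. This requires the one
  without the top exponent not to vanish at \<open>s\<close>, which is the bound on the number of zeros.
\<close>
lemma exists_sparse_polynomial_with_zeros: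
  fixes n :: "nat \<Rightarrow> nat" and S :: "real set"
  assumes "strict_mono_on {..N} n" and "finite S" and "card S = N" and "S \<subseteq> {0<..}"
  shows "\<exists>b. b N = 1 \<and> (\<forall>t\<in>S. (\<Sum>j\<le>N. b j * t ^ n j) = 0)"
  using assms
proof (induction N arbitrary: n S)
  case 0
  then show ?case by (intro exI[of _ "\<lambda>_. 1"]) auto
next
  case (Suc N)
  obtain s S' where S: "S = insert s S'" "s \<notin> S'" using Suc.prems(3) by (metis card_Suc_eq)
  have S': "finite S'" "card S' = N" "S' \<subseteq> {0<..}" using Suc.prems S by auto
  have mono: "n i < n j" if "i < j" "j \<le> Suc N" for i j
    using that Suc.prems(1) by (auto simp: strict_mono_on_def)
  have mono1: "strict_mono_on {..N} n" by (auto simp: strict_mono_on_def mono)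
  have mono2: "strict_mono_on {..N} (n(N := n (Suc N)))"
    by (auto simp: strict_mono_on_def mono)
  obtain q where q: "q N = 1" "\<And>t. t \<in> S' \<Longrightarrow> (\<Sum>j\<le>N. q j * t ^ n j) = 0"
    using Suc.IH[OF mono1 S'] by blast
  obtain p where p: "p N = 1" "\<And>t. t \<in> S' \<Longrightarrow> (\<Sum>j\<le>N. p j * t ^ (n(N := n (Suc N))) j) = 0"
    using Suc.IH[OF mono2 S'] by blast
  define Q where "Q t = (\<Sum>j\<le>N. q j * t ^ n j)" for t :: real
  define P where "P t = (\<Sum>j<N. p j * t ^ n j) + t ^ n (Suc N)" for t :: real
  have P0: "P t = 0" if "t \<in> S'" for t
  proof -
    have "P t = (\<Sum>j\<le>N. p j * t ^ (n(N := n (Suc N))) j)"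
      by (simp add: P_def p lessThan_Suc_atMost[symmetric])
    then show ?thesis using p(2)[OF that] by simp
  qed
  have Qs: "Q s \<noteq> 0"
  proof
    assume Qs0: "Q s = 0"
    define r where "r = Max S + 1"
    have Sr: "S \<subseteq> {0<..<r}"
    proof
      fix t assume t: "t \<in> S"
      then have "t \<le> Max S" using Suc.prems by simp
      then show "t \<in> {0<..<r}" using t Suc.prems(4) by (auto simp: r_def)
    qed
    then have r: "r > 0" using S by auto
    obtain C where C: "leading_coeff_dominates (Suc N) n r C"
      using exists_leading_coeff_bound[OF Suc.prems(1) r] by blast
    \<comment> \<open>Regarded as a polynomial with vanishing coefficient at \<open>n (Suc N)\<close>, \<open>q\<close> would have one zero
      too many.\<close>
    define b where "b = q(Suc N := 0)"
    have "(\<Sum>j\<le>Suc N. b j * t ^ n j) = 0" if "t \<in> S" for t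
      using that S q(2) Qs0 by (auto simp: b_def Q_def)
    then have "\<bar>b N\<bar> \<le> C * \<bar>b (Suc N)\<bar>"
      using leading_coeff_dominatesD[OF C Suc.prems(2,3) Sr, of b N] by simp
    then show False using q(1) by (simp add: b_def)
  qed
  define w where "w = P s / Q s"
  define b where "b j = (if j < N then p j - w * q j else if j = N then - w else 1)" for j
  have eq: "(\<Sum>j\<le>Suc N. b j * t ^ n j) = P t - w * Q t" for t :: real
    by (simp add: b_def P_def Q_def q lessThan_Suc_atMost[symmetric] sum_distrib_left
        sum_subtractf algebra_simps)
  show ?case
  proof (intro exI[of _ b] conjI ballI)
    show "b (Suc N) = 1" by (simp add: b_def)
    fix t assume "t \<in> S"
    then show "(\<Sum>j\<le>Suc N. b j * t ^ n j) = 0"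
      unfolding eq using S P0 q(2) Qs by (auto simp: w_def Q_def)
  qed
qed

section \<open>Real positive semidefinite matrices and the Schur product theorem\<close>

text \<open>
  Matrices are functions of which only the entries with both indices below \<open>N\<close> count, so that passing
  to a leading block in an induction on \<open>N\<close> does not change the matrix.
\<close>
definition quad_form :: "nat \<Rightarrow> (nat \<Rightarrow> nat \<Rightarrow> real) \<Rightarrow> (nat \<Rightarrow> real) \<Rightarrow> real" where
  "quad_form N A x = (\<Sum>i<N. \<Sum>j<N. A i j * x i * x j)"

definition real_psd :: "nat \<Rightarrow> (nat \<Rightarrow> nat \<Rightarrow> real) \<Rightarrow> bool" where
  "real_psd N A \<longleftrightarrow> (\<forall>i<N. \<forall>j<N. A i j = A j i) \<and> (\<forall>x. quad_form N A x \<ge> 0)"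

lemma real_psd_sym: "real_psd N A \<Longrightarrow> i < N \<Longrightarrow> j < N \<Longrightarrow> A i j = A j i"
  by (simp add: real_psd_def)

lemma real_psd_nonneg: "real_psd N A \<Longrightarrow> quad_form N A x \<ge> 0"
  by (simp add: real_psd_def)

lemma quad_form_cong:
  "(\<And>i j. i < N \<Longrightarrow> j < N \<Longrightarrow> A i j = B i j) \<Longrightarrow> (\<And>i. i < N \<Longrightarrow> x i = y i) \<Longrightarrow>
     quad_form N A x = quad_form N B y"
  by (auto simp: quad_form_def intro!: sum.cong)

lemma real_psd_cong:
  assumes "\<And>i j. i < N \<Longrightarrow> j < N \<Longrightarrow> A i j = B i j"
  shows "real_psd N A \<longleftrightarrow> real_psd N B"
  using assms quad_form_cong[of N A B] by (simp add: real_psd_def)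

lemma quad_form_add: "quad_form N (\<lambda>i j. A i j + B i j) x = quad_form N A x + quad_form N B x"
  by (simp add: quad_form_def algebra_simps sum.distrib)

lemma quad_form_diff: "quad_form N (\<lambda>i j. A i j - B i j) x = quad_form N A x - quad_form N B x"
  by (simp add: quad_form_def algebra_simps sum_subtractf)

lemma quad_form_scale: "quad_form N (\<lambda>i j. k * A i j) x = k * quad_form N A x"
  by (simp add: quad_form_def sum_distrib_left mult.assoc)

lemma quad_form_outer: "quad_form N (\<lambda>i j. u i * u j) x = (\<Sum>i<N. u i * x i)\<^sup>2"
  by (simp add: quad_form_def power2_eq_square sum_product mult_ac)

lemma quad_form_sum: "quad_form N (\<lambda>i j. \<Sum>k\<in>I. A k i j) x = (\<Sum>k\<in>I. quad_form N (A k) x)"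
proof -
  have "quad_form N (\<lambda>i j. \<Sum>k\<in>I. A k i j) x = (\<Sum>i<N. \<Sum>j<N. \<Sum>k\<in>I. A k i j * x i * x j)"
    by (simp add: quad_form_def sum_distrib_right)
  also have "\<dots> = (\<Sum>i<N. \<Sum>k\<in>I. \<Sum>j<N. A k i j * x i * x j)"
    by (intro sum.cong refl) (rule sum.swap)
  also have "\<dots> = (\<Sum>k\<in>I. \<Sum>i<N. \<Sum>j<N. A k i j * x i * x j)"
    by (rule sum.swap)
  finally show ?thesis by (simp add: quad_form_def)
qed

lemma quad_form_delta: "k < N \<Longrightarrow> quad_form N A (\<lambda>i. if i = k then 1 else 0) = A k k"
proof -
  assume k: "k < N"
  have "quad_form N A (\<lambda>i. if i = k then 1 else 0) =
      (\<Sum>i<N. \<Sum>j<N. if j = k then (if i = k then A i j else 0) else 0)"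
    unfolding quad_form_def by (intro sum.cong refl) simp
  also have "\<dots> = A k k" using k by simp
  finally show ?thesis .
qed

lemma real_psd_add: "real_psd N A \<Longrightarrow> real_psd N B \<Longrightarrow> real_psd N (\<lambda>i j. A i j + B i j)"
  by (simp add: real_psd_def quad_form_add)

lemma real_psd_scale: "0 \<le> k \<Longrightarrow> real_psd N A \<Longrightarrow> real_psd N (\<lambda>i j. k * A i j)"
  by (simp add: real_psd_def quad_form_scale)

lemma real_psd_sum: "(\<And>k. k \<in> I \<Longrightarrow> real_psd N (A k)) \<Longrightarrow> real_psd N (\<lambda>i j. \<Sum>k\<in>I. A k i j)"
  by (auto simp: real_psd_def quad_form_sum intro!: sum.cong sum_nonneg)

lemma real_psd_outer: "real_psd N (\<lambda>i j. u i * u j)"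
  by (simp add: real_psd_def quad_form_outer)

lemma real_psd_mono: "real_psd (Suc N) A \<Longrightarrow> real_psd N A"
proof -
  assume A: "real_psd (Suc N) A"
  have "quad_form N A x = quad_form (Suc N) A (x(N := 0))" for x
    by (simp add: quad_form_def)
  with A show ?thesis by (simp add: real_psd_def)
qed

lemma quad_form_Suc:
  assumes "\<And>i. i < N \<Longrightarrow> A N i = A i N"
  shows "quad_form (Suc N) A (x(N := t)) =
           quad_form N A x + 2 * t * (\<Sum>i<N. A i N * x i) + A N N * t\<^sup>2"
proof -
  have "quad_form (Suc N) A (x(N := t)) =
      quad_form N A x + (\<Sum>i<N. A i N * x i * t) + (\<Sum>j<N. A N j * t * x j) + A N N * t\<^sup>2"
    by (simp add: quad_form_def sum.distrib power2_eq_square)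
  also have "(\<Sum>j<N. A N j * t * x j) = (\<Sum>i<N. A i N * x i * t)"
    using assms by (intro sum.cong) auto
  also have "(\<Sum>i<N. A i N * x i * t) = t * (\<Sum>i<N. A i N * x i)"
    by (simp add: sum_distrib_left mult_ac)
  finally show ?thesis by (simp only: mult_2 distrib_right add.assoc)
qed

text \<open>
  Otherwise the quadratic form would, for suitable other coordinates, be a nonconstant affine function
  of the last coordinate and so take negative values.
\<close>
lemma real_psd_zero_diagonal:
  assumes "real_psd (Suc N) A" and "A N N = 0" and "i \<le> N"
  shows "A i N = 0"
proof (cases "i = N")
  case False
  then have i: "i < N" using assms(3) by simp
  define x :: "nat \<Rightarrow> real" where "x = (\<lambda>j. if j = i then 1 else 0)"
  have L: "(\<Sum>j<N. A j N * x j) = A i N"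
    using i by (simp add: x_def if_distrib cong: if_cong)
  have ge: "0 \<le> A i i + 2 * t * A i N" for t
    using real_psd_nonneg[OF assms(1), of "x(N := t)"] real_psd_sym[OF assms(1)] assms(2) i
      quad_form_Suc[of N A x t] quad_form_delta[OF i, of A]
    by (simp add: L flip: x_def)
  show ?thesis
  proof (rule ccontr)
    assume ne: "A i N \<noteq> 0"
    have "0 \<le> A i i + 2 * (- (A i i + 1) / (2 * A i N)) * A i N" by (rule ge)
    also have "\<dots> = -1" using ne by (simp add: field_simps)
    finally show False by simp
  qed
qed (use assms in simp)

text \<open>
  The matrix minus its rank one part \<open>\<zeta> \<zeta>\<^sup>T\<close>, where \<open>\<zeta>\<close> is the last column divided by \<open>sqrt (A N N)\<close>.
  If \<open>A N N = 0\<close>, division by zero makes this \<open>A\<close> itself, which is the right value, since the last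
  column of a positive semidefinite \<open>A\<close> is then zero.
\<close>
definition schur_complement :: "nat \<Rightarrow> (nat \<Rightarrow> nat \<Rightarrow> real) \<Rightarrow> nat \<Rightarrow> nat \<Rightarrow> real" where
  "schur_complement N A i j = A i j - A i N * A j N / A N N"

lemma real_psd_diagonal_nonneg: "real_psd N A \<Longrightarrow> i < N \<Longrightarrow> 0 \<le> A i i"
  using real_psd_nonneg[of N A] quad_form_delta[of i N A] by metis

lemma schur_complement_last:
  assumes "real_psd (Suc N) A" and "i \<le> N"
  shows "schur_complement N A i N = 0" and "schur_complement N A N i = 0"
  using real_psd_zero_diagonal[OF assms(1) _ assms(2)] real_psd_sym[OF assms(1), of i N] assms(2)
  by (auto simp: schur_complement_def)

text \<open>
  If \<open>A N N > 0\<close>, the quadratic form of the Schur complement is the minimum of that of \<open>A\<close> over the last coordinate,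
  attained at \<open>t = - L / A N N\<close>.
\<close>
lemma real_psd_schur_complement:
  assumes A: "real_psd (Suc N) A"
  shows "real_psd N (schur_complement N A)"
  unfolding real_psd_def
proof (intro conjI allI impI)
  fix i j assume "i < N" "j < N"
  then show "schur_complement N A i j = schur_complement N A j i"
    using real_psd_sym[OF A, of i j] by (simp add: schur_complement_def)
next
  fix x
  define L where "L = (\<Sum>i<N. A i N * x i)"
  have eq: "quad_form N (schur_complement N A) x = quad_form N A x - L\<^sup>2 / A N N"
  proof -
    have "quad_form N (schur_complement N A) x =
        quad_form N (\<lambda>i j. A i j - 1 / A N N * (A i N * A j N)) x"
      by (rule quad_form_cong) (simp_all add: schur_complement_def)
    also have "\<dots> = quad_form N A x - 1 / A N N * L\<^sup>2"
      unfolding quad_form_diff quad_form_scale quad_form_outer L_def ..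
    finally show ?thesis by simp
  qed
  show "0 \<le> quad_form N (schur_complement N A) x"
  proof (cases "A N N = 0")
    case True
    then show ?thesis unfolding eq using real_psd_nonneg[OF real_psd_mono[OF A]] by simp
  next
    case False
    have "0 \<le> quad_form (Suc N) A (x(N := - L / A N N))" by (rule real_psd_nonneg[OF A])
    also have "\<dots> = quad_form N A x + 2 * (- L / A N N) * L + A N N * (- L / A N N)\<^sup>2"
      unfolding L_def by (rule quad_form_Suc) (rule real_psd_sym[OF A], auto)
    also have "\<dots> = quad_form N A x - L\<^sup>2 / A N N"
      using False by (simp add: power2_eq_square field_simps)
    finally show ?thesis unfolding eq .
  qed
qed

text \<open>
  A Cholesky decomposition: splitting off the rank one part given by the last column leaves the Schur
  complement, which has one dimension less.
\<close>
lemma real_psd_gram: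
  assumes "real_psd N A"
  shows "\<exists>W. \<forall>i<N. \<forall>j<N. A i j = (\<Sum>k<N. W k i * W k j)"
  using assms
proof (induction N arbitrary: A)
  case 0
  then show ?case by simp
next
  case (Suc N)
  obtain W where W: "\<And>i j. i < N \<Longrightarrow> j < N \<Longrightarrow> schur_complement N A i j = (\<Sum>k<N. W k i * W k j)"
    using Suc.IH[OF real_psd_schur_complement[OF Suc.prems]] by blast
  define V where "V k i = (if k = N then A i N / sqrt (A N N) else if i = N then 0 else W k i)" for k i
  have "A i j = (\<Sum>k<Suc N. V k i * V k j)" if ij: "i < Suc N" "j < Suc N" for i j
  proof -
    have "(\<Sum>k<N. V k i * V k j) = schur_complement N A i j"
    proof (cases "i < N \<and> j < N")
      case True
      then show ?thesis using W[of i j] by (simp add: V_def)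
    next
      case False
      then have "i = N \<or> j = N" using ij by auto
      then show ?thesis using schur_complement_last[OF Suc.prems] ij by (auto simp: V_def)
    qed
    moreover have "V N i * V N j = A i N * A j N / A N N"
      using real_psd_diagonal_nonneg[OF Suc.prems, of N] by (simp add: V_def)
    ultimately show ?thesis by (simp add: schur_complement_def)
  qed
  then show ?case by blast
qed

text \<open>
  The Schur product theorem. For a rank one factor \<open>w w\<^sup>T\<close> the quadratic form of the product is that
  of the other factor at the rescaled vector \<open>w\<^sub>i x\<^sub>i\<close>; the Gram decomposition reduces to this case.
\<close>
lemma real_psd_hadamard:
  assumes A: "real_psd N A" and B: "real_psd N B"
  shows "real_psd N (\<lambda>i j. A i j * B i j)"
proof -
  obtain W where W: "\<And>i j. i < N \<Longrightarrow> j < N \<Longrightarrow> A i j = (\<Sum>k<N. W k i * W k j)"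
    using real_psd_gram[OF A] by blast
  have "real_psd N (\<lambda>i j. W k i * W k j * B i j)" for k
  proof -
    have "quad_form N (\<lambda>i j. W k i * W k j * B i j) x = quad_form N B (\<lambda>i. W k i * x i)" for x
      by (simp add: quad_form_def mult_ac)
    then show ?thesis using B by (simp add: real_psd_def mult_ac)
  qed
  then have "real_psd N (\<lambda>i j. \<Sum>k<N. W k i * W k j * B i j)" by (rule real_psd_sum)
  moreover have "real_psd N (\<lambda>i j. A i j * B i j) \<longleftrightarrow>
      real_psd N (\<lambda>i j. \<Sum>k<N. W k i * W k j * B i j)"
    by (rule real_psd_cong) (simp add: W sum_distrib_right)
  ultimately show ?thesis by simp
qed

lemma real_psd_power:
  assumes "real_psd N A"
  shows "real_psd N (\<lambda>i j. A i j ^ m)"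
proof (induction m)
  case 0
  show ?case using real_psd_outer[of N "\<lambda>_. 1"] by simp
next
  case (Suc m)
  show ?case using real_psd_hadamard[OF assms Suc] by simp
qed

section \<open>Domination of a power by lower powers\<close>

abbreviation entries_between :: "nat \<Rightarrow> (nat \<Rightarrow> nat \<Rightarrow> real) \<Rightarrow> real \<Rightarrow> bool" where
  "entries_between N A \<rho> \<equiv> \<forall>i<N. \<forall>j<N. 0 < A i j \<and> A i j < \<rho>"

text \<open>
  The claim \<open>x^M[u u\<^sup>T] \<le> K h[u u\<^sup>T]\<close> in terms of quadratic forms. Interpolating \<open>u\<^sub>i ^ M\<close> by the lower
  powers turns the left side into \<open>(\<Sum>\<^sub>k b\<^sub>k y\<^sub>k)\<^sup>2\<close> with \<open>y\<^sub>k = \<Sum>\<^sub>i x\<^sub>i u\<^sub>i ^ n\<^sub>k\<close>, and the bound on the \<open>b\<^sub>k\<close>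
  depends on \<open>r\<close> but not on \<open>u\<close>.
\<close>
lemma rank_one_domination:
  fixes n :: "nat \<Rightarrow> nat" and c :: "nat \<Rightarrow> real"
  assumes mono: "strict_mono_on {..<N} n" and M: "\<And>j. j < N \<Longrightarrow> n j < M"
    and c: "\<And>j. j < N \<Longrightarrow> c j > 0" and r: "r > 0"
  shows "\<exists>K. \<forall>u x. (\<forall>i<N. 0 < u i \<and> u i < r) \<longrightarrow>
           (\<Sum>i<N. x i * u i ^ M)\<^sup>2 \<le> K * (\<Sum>k<N. c k * (\<Sum>i<N. x i * u i ^ n k)\<^sup>2)"
proof -
  define e where "e = n(N := M)"
  have e: "strict_mono_on {..N} e"
    using mono M by (auto simp: e_def strict_mono_on_def)
  obtain C where C0: "C \<ge> 0" and C: "leading_coeff_dominates N e r C"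
    using exists_leading_coeff_bound[OF e r] by blast
  define K where "K = C\<^sup>2 * (\<Sum>k<N. 1 / c k)"
  have "(\<Sum>i<N. x i * u i ^ M)\<^sup>2 \<le> K * (\<Sum>k<N. c k * (\<Sum>i<N. x i * u i ^ n k)\<^sup>2)"
    if u: "\<forall>i<N. 0 < u i \<and> u i < r" for u x :: "nat \<Rightarrow> real"
  proof -
    \<comment> \<open>The \<open>u i\<close> need not be distinct; the set of their values is padded to exactly \<open>N\<close> points.\<close>
    define S0 where "S0 = u ` {..<N}"
    have S0: "finite S0" "card S0 \<le> N" "S0 \<subseteq> {0<..<r}"
      using u card_image_le[of "{..<N}" u] by (auto simp: S0_def)
    have "infinite ({0<..<r} - S0)" using r S0(1) by (simp add: infinite_Ioo)
    then obtain S1 where S1: "finite S1" "card S1 = N - card S0" "S1 \<subseteq> {0<..<r} - S0"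
      using infinite_arbitrarily_large by blast
    define S where "S = S0 \<union> S1"
    have S: "finite S" "card S = N" "S \<subseteq> {0<..<r}"
      using S0 S1 card_Un_disjoint[of S0 S1] by (auto simp: S_def)
    have "S \<subseteq> {0<..}" using S(3) by auto
    then obtain b where b: "b N = 1" "\<And>t. t \<in> S \<Longrightarrow> (\<Sum>j\<le>N. b j * t ^ e j) = 0"
      using exists_sparse_polynomial_with_zeros[OF e S(1,2)] by blast
    have bC: "\<bar>b k\<bar> \<le> C" if "k < N" for k
      using leading_coeff_dominatesD[OF C S b(2), of k] that b(1) by simp
    define y where "y k = (\<Sum>i<N. x i * u i ^ n k)" for k
    have pw: "u i ^ M = - (\<Sum>k<N. b k * u i ^ n k)" if "i < N" for i
    proof -
      have "u i \<in> S" using that by (simp add: S_def S0_def)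
      from b(2)[OF this] have "(\<Sum>k<N. b k * u i ^ n k) + u i ^ M = 0"
        by (simp add: lessThan_Suc_atMost[symmetric] b(1) e_def)
      then show ?thesis by simp
    qed
    have "(\<Sum>i<N. x i * u i ^ M) = - (\<Sum>i<N. \<Sum>k<N. b k * (x i * u i ^ n k))"
      by (simp add: pw sum_distrib_left sum_negf mult_ac)
    also have "(\<Sum>i<N. \<Sum>k<N. b k * (x i * u i ^ n k)) = (\<Sum>k<N. b k * y k)"
      unfolding y_def sum_distrib_left by (rule sum.swap)
    finally have "(\<Sum>i<N. x i * u i ^ M)\<^sup>2 = (\<Sum>k<N. b k * y k)\<^sup>2" by simp
    also have "\<dots> = (\<Sum>k<N. (b k / sqrt (c k)) * (sqrt (c k) * y k))\<^sup>2"
      using c by (intro arg_cong[where f = "\<lambda>s. s\<^sup>2"] sum.cong) (auto dest: less_imp_neq[symmetric])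
    also have "\<dots> \<le> (\<Sum>k<N. (b k / sqrt (c k))\<^sup>2) * (\<Sum>k<N. (sqrt (c k) * y k)\<^sup>2)"
      by (rule Cauchy_Schwarz_ineq_sum)
    also have "(\<Sum>k<N. (sqrt (c k) * y k)\<^sup>2) = (\<Sum>k<N. c k * (y k)\<^sup>2)"
      using c by (intro sum.cong) (auto simp: power_mult_distrib less_imp_le)
    also have "(\<Sum>k<N. (b k / sqrt (c k))\<^sup>2) * (\<Sum>k<N. c k * (y k)\<^sup>2) \<le> K * (\<Sum>k<N. c k * (y k)\<^sup>2)"
    proof (rule mult_right_mono)
      show "(\<Sum>k<N. (b k / sqrt (c k))\<^sup>2) \<le> K"
        unfolding K_def sum_distrib_left
      proof (rule sum_mono)
        fix k assume "k \<in> {..<N}"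
        then have k: "k < N" by simp
        have "(b k)\<^sup>2 \<le> C\<^sup>2" using bC[OF k] C0 by (simp add: abs_le_square_iff[symmetric])
        then show "(b k / sqrt (c k))\<^sup>2 \<le> C\<^sup>2 * (1 / c k)"
          using c[OF k] by (simp add: power_divide divide_right_mono)
      qed
      show "0 \<le> (\<Sum>k<N. c k * (y k)\<^sup>2)" using c by (intro sum_nonneg) (auto simp: less_imp_le)
    qed
    finally show ?thesis by (simp add: y_def)
  qed
  then have "\<forall>u x. (\<forall>i<N. 0 < u i \<and> u i < r) \<longrightarrow>
      (\<Sum>i<N. x i * u i ^ M)\<^sup>2 \<le> K * (\<Sum>k<N. c k * (\<Sum>i<N. x i * u i ^ n k)\<^sup>2)"
    by simp
  then show ?thesis ..
qed

text \<open>
  The FitzGerald--Horn argument. \<open>C t\<close> runs from the rank one matrix \<open>u u\<^sup>T\<close> with the same last row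
  and column to \<open>A\<close>, and the quadratic form of \<open>f[C t]\<close> is nondecreasing in \<open>t\<close>. Every \<open>C t\<close> has entries
  in \<open>(0, \<rho>)\<close>, since \<open>u\<^sub>i\<^sup>2 \<le> A i i < \<rho>\<close>, so the hypothesis on \<open>f'\<close> applies to its leading block.
\<close>
lemma real_psd_deform_from_rank_one:
  fixes f f' :: "real \<Rightarrow> real"
  assumes A: "real_psd (Suc N) A" and ent: "entries_between (Suc N) A \<rho>"
    and f: "\<And>x. (f has_real_derivative f' x) (at x)"
    and rank1: "\<And>u x. \<forall>i<Suc N. 0 < u i \<and> u i < sqrt \<rho> \<Longrightarrow>
                   0 \<le> quad_form (Suc N) (\<lambda>i j. f (u i * u j)) x"
    and deriv: "\<And>C. real_psd N C \<Longrightarrow> entries_between N C \<rho> \<Longrightarrow> real_psd N (\<lambda>i j. f' (C i j))"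
  shows "real_psd (Suc N) (\<lambda>i j. f (A i j))"
proof -
  let ?D = "schur_complement N A"
  have aN: "A N N > 0" using ent by simp
  define u where "u i = A i N / sqrt (A N N)" for i
  have AD: "A i j = u i * u j + ?D i j" for i j
    using aN by (simp add: u_def schur_complement_def)
  have D: "real_psd N ?D" by (rule real_psd_schur_complement[OF A])
  have D0: "?D i N = 0" "?D N i = 0" if "i \<le> N" for i
    using schur_complement_last[OF A that] by auto
  have u: "0 < u i \<and> u i < sqrt \<rho>" if i: "i < Suc N" for i
  proof
    show "0 < u i" using ent i aN by (simp add: u_def)
    have "0 \<le> ?D i i"
      using real_psd_diagonal_nonneg[OF D, of i] D0(1)[of i] i by (cases "i = N") auto
    moreover have "A i i < \<rho>" using ent i by simp
    ultimately have "(u i)\<^sup>2 < \<rho>" using AD[of i i] by (simp add: power2_eq_square)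
    then show "u i < sqrt \<rho>" by (rule real_less_rsqrt)
  qed
  define C where "C t i j = u i * u j + t * ?D i j" for t i j
  have C_ent: "0 < C t i j \<and> C t i j < \<rho>" if t: "0 \<le> t" "t \<le> 1" and ij: "i < Suc N" "j < Suc N" for t i j
  proof -
    have \<rho>: "\<rho> > 0" using ent by (meson less_trans zero_less_Suc)
    have "u i * u j < sqrt \<rho> * sqrt \<rho>" using u[OF ij(1)] u[OF ij(2)] \<rho> by (intro mult_strict_mono) auto
    then have ub: "u i * u j < \<rho>" using \<rho> by simp
    have lb: "0 < u i * u j" using u[OF ij(1)] u[OF ij(2)] by simp
    have Aij: "0 < A i j" "A i j < \<rho>" using ent ij by auto
    have eq: "C t i j = (1 - t) * (u i * u j) + t * A i j"
      using AD[of i j] by (simp add: C_def algebra_simps)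
    show ?thesis
    proof (cases "t = 1")
      case True then show ?thesis using eq Aij by simp
    next
      case False
      with t have t1: "0 < 1 - t" by simp
      have "0 < (1 - t) * (u i * u j)" "0 \<le> t * A i j" using t1 lb t Aij by auto
      moreover have "(1 - t) * (u i * u j) < (1 - t) * \<rho>" "t * A i j \<le> t * \<rho>"
        using t1 ub t Aij by (auto intro: mult_strict_left_mono mult_left_mono)
      ultimately show ?thesis unfolding eq by (simp add: algebra_simps)
    qed
  qed
  have "0 \<le> quad_form (Suc N) (\<lambda>i j. f (A i j)) x" for x
  proof -
    define g where "g t = quad_form (Suc N) (\<lambda>i j. f (C t i j)) x" for t
    have "g 0 \<le> g 1"
    proof (rule DERIV_nonneg_imp_nondecreasing[where f = g and a = 0 and b = 1])
      fix t :: real assume t: "0 \<le> t" "t \<le> 1"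
      have "real_psd N (C t)"
        unfolding C_def by (intro real_psd_add real_psd_outer real_psd_scale t D)
      moreover have "entries_between N (C t) \<rho>" using C_ent[OF t] by simp
      ultimately have "real_psd N (\<lambda>i j. ?D i j * f' (C t i j))"
        by (intro real_psd_hadamard D deriv)
      then have nn: "0 \<le> quad_form N (\<lambda>i j. ?D i j * f' (C t i j)) x" by (rule real_psd_nonneg)
      have "(g has_real_derivative (\<Sum>i<Suc N. \<Sum>j<Suc N. f' (C t i j) * ?D i j * x i * x j)) (at t)"
        unfolding g_def quad_form_def C_def
        by (intro DERIV_sum DERIV_cmult_right DERIV_chain2[OF f]) (auto intro!: derivative_eq_intros)
      also have "(\<Sum>i<Suc N. \<Sum>j<Suc N. f' (C t i j) * ?D i j * x i * x j) =
          quad_form N (\<lambda>i j. ?D i j * f' (C t i j)) x"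
        by (simp add: D0 quad_form_def mult_ac)
      finally show "\<exists>y. DERIV g t :> y \<and> 0 \<le> y" using nn by blast
    qed simp
    moreover have "0 \<le> g 0" using rank1[of u x] u by (simp add: g_def C_def)
    moreover have "g 1 = quad_form (Suc N) (\<lambda>i j. f (A i j)) x" by (simp add: g_def C_def AD)
    ultimately show ?thesis by simp
  qed
  then show ?thesis using real_psd_sym[OF A] by (simp add: real_psd_def)
qed

text \<open>
  Induction on \<open>N\<close>. The derivative of \<open>K h - x^M\<close> is \<open>M\<close> times an expression of the same kind with
  the \<open>N\<close> exponents \<open>n 1 - 1 < \<dots> < n N - 1\<close> and the power \<open>M - 1\<close>, plus monomials with nonnegative
  coefficients. The exponent \<open>n 0\<close> contributes only such a monomial, or nothing if \<open>n 0 = 0\<close>.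
\<close>
lemma power_dominated_by_lower_powers:
  fixes n :: "nat \<Rightarrow> nat" and c :: "nat \<Rightarrow> real"
  assumes "strict_mono_on {..<N} n" and "\<And>j. j < N \<Longrightarrow> n j < M"
    and "\<And>j. j < N \<Longrightarrow> c j > 0" and \<rho>: "\<rho> > 0"
  shows "\<exists>K. \<forall>A. real_psd N A \<longrightarrow> entries_between N A \<rho> \<longrightarrow>
           real_psd N (\<lambda>i j. K * (\<Sum>k<N. c k * A i j ^ n k) - A i j ^ M)"
  using assms(1-3)
proof (induction N arbitrary: n c M)
  case 0
  show ?case by (simp add: real_psd_def quad_form_def)
next
  case (Suc N)
  have less: "n i < n j" if "i < j" "j \<le> N" for i j
    using Suc.prems(1) that by (auto simp: strict_mono_on_def)
  define n' where "n' k = n (Suc k) - 1" for k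
  define c' where "c' k = c (Suc k) * real (n (Suc k))" for k
  have pos: "0 < n (Suc k)" if "k < N" for k using less[of 0 "Suc k"] that by simp
  have mono': "strict_mono_on {..<N} n'"
  proof (rule strict_mono_onI)
    fix i j assume "i \<in> {..<N}" "j \<in> {..<N}" "i < j"
    then show "n' i < n' j" using less[of "Suc i" "Suc j"] pos[of i] by (simp add: n'_def)
  qed
  have M': "n' k < M - 1" if "k < N" for k
    using Suc.prems(2)[of "Suc k"] pos[of k] that by (simp add: n'_def)
  have c'pos: "c' k > 0" if "k < N" for k
    using Suc.prems(3)[of "Suc k"] pos[of k] that by (simp add: c'_def)
  have cpos: "c k \<ge> 0" if "k < Suc N" for k using Suc.prems(3)[OF that] by simp
  from Suc.IH[OF mono' M' c'pos]
  obtain K2 where K2: "\<forall>C. real_psd N C \<longrightarrow> entries_between N C \<rho> \<longrightarrow>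
      real_psd N (\<lambda>i j. K2 * (\<Sum>k<N. c' k * C i j ^ n' k) - C i j ^ (M - 1))" ..
  have sqrt_pos: "sqrt \<rho> > 0" using \<rho> by simp
  from rank_one_domination[OF Suc.prems sqrt_pos]
  obtain K1 where K1: "\<forall>u x. (\<forall>i<Suc N. 0 < u i \<and> u i < sqrt \<rho>) \<longrightarrow>
      (\<Sum>i<Suc N. x i * u i ^ M)\<^sup>2 \<le> K1 * (\<Sum>k<Suc N. c k * (\<Sum>i<Suc N. x i * u i ^ n k)\<^sup>2)" ..
  \<comment> \<open>\<open>K1\<close> handles the rank one matrices, \<open>real M * K2\<close> the derivative.\<close>
  define K where "K = max 0 (max K1 (real M * K2))"
  have K: "0 \<le> K" "K1 \<le> K" "real M * K2 \<le> K" by (auto simp: K_def)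
  define f where "f x = K * (\<Sum>k<Suc N. c k * x ^ n k) - x ^ M" for x :: real
  define f' where "f' x = K * (\<Sum>k<Suc N. c k * (real (n k) * x ^ (n k - 1))) - real M * x ^ (M - 1)" for x :: real
  have der: "(f has_real_derivative f' x) (at x)" for x
    unfolding f_def f'_def by (intro DERIV_diff DERIV_cmult DERIV_sum) (auto intro!: derivative_eq_intros)
  have rank1: "0 \<le> quad_form (Suc N) (\<lambda>i j. f (u i * u j)) x"
    if u: "\<forall>i<Suc N. 0 < u i \<and> u i < sqrt \<rho>" for u x
  proof -
    let ?s = "\<Sum>k<Suc N. c k * (\<Sum>i<Suc N. x i * u i ^ n k)\<^sup>2"
    have q: "quad_form (Suc N) (\<lambda>i j. (u i * u j) ^ m) x = (\<Sum>i<Suc N. x i * u i ^ m)\<^sup>2" for m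
      unfolding power_mult_distrib quad_form_outer by (simp only: mult.commute)
    have "quad_form (Suc N) (\<lambda>i j. f (u i * u j)) x = K * ?s - (\<Sum>i<Suc N. x i * u i ^ M)\<^sup>2"
      unfolding f_def quad_form_diff quad_form_scale quad_form_sum q ..
    moreover have "K1 * ?s \<le> K * ?s"
      using K cpos by (intro mult_right_mono sum_nonneg mult_nonneg_nonneg) auto
    ultimately show ?thesis using K1[rule_format, of u x] u by simp
  qed
  have deriv: "real_psd N (\<lambda>i j. f' (C i j))" if C: "real_psd N C" "entries_between N C \<rho>" for C
  proof -
    have eq: "f' t = (real M * (K2 * (\<Sum>k<N. c' k * t ^ n' k) - t ^ (M - 1))
        + (K - real M * K2) * (\<Sum>k<N. c' k * t ^ n' k)) + (K * c 0 * real (n 0)) * t ^ (n 0 - 1)" for t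
      unfolding f'_def sum.lessThan_Suc_shift by (simp add: c'_def n'_def algebra_simps)
    have "0 \<le> K * c 0 * real (n 0)" using K cpos[of 0] by simp
    moreover have "real_psd N (\<lambda>i j. K2 * (\<Sum>k<N. c' k * C i j ^ n' k) - C i j ^ (M - 1))"
      using K2 C by blast
    ultimately show ?thesis
      unfolding eq using K c'pos
      by (intro real_psd_add real_psd_scale real_psd_sum real_psd_power C) (auto simp: less_imp_le)
  qed
  show ?case
  proof (intro exI[of _ K] allI impI)
    fix A assume A: "real_psd (Suc N) A" "entries_between (Suc N) A \<rho>"
    have "real_psd (Suc N) (\<lambda>i j. f (A i j))"
      by (rule real_psd_deform_from_rank_one[OF A der rank1 deriv])
    then show "real_psd (Suc N) (\<lambda>i j. K * (\<Sum>k<Suc N. c k * A i j ^ n k) - A i j ^ M)"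
      unfolding f_def .
  qed
qed

section \<open>Complex matrices with real entries\<close>

lemma mat_adjoint_eq_iff:
  assumes A: "A \<in> carrier_mat N N"
  shows "mat_adjoint A = A \<longleftrightarrow> (\<forall>i<N. \<forall>j<N. A $$ (i, j) = conjugate (A $$ (j, i)))"
proof -
  have idx: "mat_adjoint A $$ (i, j) = conjugate (A $$ (j, i))" if "i < N" "j < N" for i j
    using that A by (simp add: mat_adjoint_def mat_of_rows_def)
  have dims: "mat_adjoint A \<in> carrier_mat N N"
    using A by (intro carrier_matI) (simp_all add: mat_adjoint_def)
  show ?thesis
  proof
    assume eq: "mat_adjoint A = A"
    show "\<forall>i<N. \<forall>j<N. A $$ (i, j) = conjugate (A $$ (j, i))"
      using idx[unfolded eq] by (intro allI impI)
  next
    assume sym: "\<forall>i<N. \<forall>j<N. A $$ (i, j) = conjugate (A $$ (j, i))"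
    show "mat_adjoint A = A"
    proof (rule eq_matI)
      fix i j assume "i < dim_row A" "j < dim_col A"
      then have ij: "i < N" "j < N" using A by auto
      then show "mat_adjoint A $$ (i, j) = A $$ (i, j)"
        using idx[OF ij] sym by metis
    qed (use A dims in auto)
  qed
qed

text \<open>
  With real entries the real and imaginary parts of \<open>v\<close> decouple, so complex test vectors give no more
  than real ones.
\<close>
lemma Re_sesquilinear_real_entries:
  assumes A: "A \<in> carrier_mat N N" and v: "v \<in> carrier_vec N"
    and B: "\<And>i j. i < N \<Longrightarrow> j < N \<Longrightarrow> A $$ (i, j) = complex_of_real (B i j)"
  shows "Re ((A *\<^sub>v v) \<bullet>c v) =
           quad_form N B (\<lambda>i. Re (v $ i)) + quad_form N B (\<lambda>i. Im (v $ i))"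
proof -
  have "(A *\<^sub>v v) \<bullet>c v = (\<Sum>i<N. (\<Sum>j<N. complex_of_real (B i j) * v $ j) * cnj (v $ i))"
    using A v B by (auto simp: scalar_prod_def atLeast0LessThan intro!: sum.cong)
  also have "Re \<dots> = (\<Sum>i<N. \<Sum>j<N. B i j * Re (v $ i) * Re (v $ j) + B i j * Im (v $ i) * Im (v $ j))"
    by (simp add: sum_distrib_right sum_distrib_left algebra_simps sum.distrib)
  finally show ?thesis by (simp add: quad_form_def sum.distrib)
qed

lemma psd_mat_real_entries_iff:
  assumes A: "A \<in> carrier_mat N N"
    and B: "\<And>i j. i < N \<Longrightarrow> j < N \<Longrightarrow> A $$ (i, j) = complex_of_real (B i j)"
  shows "psd_mat A \<longleftrightarrow> real_psd N B"
proof -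
  have herm: "hermitian_mat A \<longleftrightarrow> (\<forall>i<N. \<forall>j<N. B i j = B j i)"
    unfolding hermitian_mat_def mat_adjoint_eq_iff[OF A] by (simp add: B)
  have form: "(\<forall>v\<in>carrier_vec (dim_row A). Re ((A *\<^sub>v v) \<bullet>c v) \<ge> 0) \<longleftrightarrow> (\<forall>x. quad_form N B x \<ge> 0)"
  proof (intro iffI allI ballI)
    fix x
    assume nonneg: "\<forall>v\<in>carrier_vec (dim_row A). Re ((A *\<^sub>v v) \<bullet>c v) \<ge> 0"
    define v where "v = vec N (\<lambda>i. complex_of_real (x i))"
    have v: "v \<in> carrier_vec N" by (simp add: v_def)
    then have "0 \<le> Re ((A *\<^sub>v v) \<bullet>c v)" using nonneg A by simp
    also have "\<dots> = quad_form N B (\<lambda>i. Re (v $ i)) + quad_form N B (\<lambda>i. Im (v $ i))"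
      by (rule Re_sesquilinear_real_entries[OF A v B])
    also have "quad_form N B (\<lambda>i. Re (v $ i)) = quad_form N B x"
      by (rule quad_form_cong) (simp_all add: v_def)
    also have "quad_form N B (\<lambda>i. Im (v $ i)) = 0"
      by (simp add: quad_form_def v_def)
    finally show "0 \<le> quad_form N B x" by simp
  next
    fix v :: "complex vec"
    assume "\<forall>x. quad_form N B x \<ge> 0" "v \<in> carrier_vec (dim_row A)"
    then show "Re ((A *\<^sub>v v) \<bullet>c v) \<ge> 0"
      using Re_sesquilinear_real_entries[OF A _ B, of v] A by auto
  qed
  show ?thesis unfolding psd_mat_def real_psd_def herm form ..
qed

lemma entrywise_positivity_preserver_of_real:
  assumes g: "\<And>B. real_psd N B \<Longrightarrow> entries_between N B \<rho> \<Longrightarrow> real_psd N (\<lambda>i j. g (B i j))"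
  shows "entrywise_positivity_preserver (\<lambda>z. complex_of_real (g (Re z))) N
           (complex_of_real ` {0<..<\<rho>})"
  unfolding entrywise_positivity_preserver_def
proof
  fix A assume "A \<in> psd_mats_on N (complex_of_real ` {0<..<\<rho>})"
  then have A: "A \<in> carrier_mat N N" "psd_mat A" "elements_mat A \<subseteq> complex_of_real ` {0<..<\<rho>}"
    by (auto simp: psd_mats_on_def)
  define B where "B i j = Re (A $$ (i, j))" for i j
  have el: "A $$ (i, j) = complex_of_real (B i j) \<and> 0 < B i j \<and> B i j < \<rho>" if "i < N" "j < N" for i j
  proof -
    have "A $$ (i, j) \<in> elements_mat A" using A(1) that by blast
    then show ?thesis using A(3) by (auto simp: B_def)
  qed
  have "real_psd N B" using psd_mat_real_entries_iff[OF A(1), of B] A(2) el by simp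
  then have "real_psd N (\<lambda>i j. g (B i j))" using el by (intro g) auto
  moreover have "psd_mat (map_mat (\<lambda>z. complex_of_real (g (Re z))) A) \<longleftrightarrow> real_psd N (\<lambda>i j. g (B i j))"
    using A(1) by (intro psd_mat_real_entries_iff) (auto simp: B_def)
  ultimately show "psd_mat (map_mat (\<lambda>z. complex_of_real (g (Re z))) A)" by simp
qed

section \<open>Power series with prescribed signs\<close>

theorem theorem1p5:
  fixes N :: nat and n :: "nat \<Rightarrow> nat" and \<epsilon> :: "nat \<Rightarrow> int"
    and \<rho> :: real and a :: "nat \<Rightarrow> real"
  assumes "N > 0"
    and "strict_mono_on {..<N} n"
    and "\<And>M. M > n (N - 1) \<Longrightarrow> \<epsilon> M \<in> {-1, 0, 1}"
    and "0 < \<rho>"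
    and "\<And>j. j < N \<Longrightarrow> a (n j) > 0"
  shows "\<exists>(f :: complex \<Rightarrow> complex) (c :: nat \<Rightarrow> real).
           (\<forall>j<N. c (n j) = a (n j)) \<and>
           (\<forall>m<n (N - 1). m \<notin> n ` {..<N} \<longrightarrow> c m = 0) \<and>
           (\<forall>x \<in> complex_of_real ` {0<..<\<rho>}. (\<lambda>m. complex_of_real (c m) * x ^ m) sums f x) \<and>
           entrywise_positivity_preserver f N (complex_of_real ` {0<..<\<rho>}) \<and>
           (\<forall>M>n (N - 1). sgn (c M) = of_int (\<epsilon> M))"
proof -
  note mono = assms(2) and sign = assms(3) and \<rho> = assms(4) and a = assms(5)
  define L where "L = n (N - 1)"
  have nL: "n j \<le> L" if "j < N" for j
  proof (cases "j = N - 1")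
    case False
    with that have "n j < n (N - 1)" using mono by (auto simp: strict_mono_on_def)
    then show ?thesis by (simp add: L_def)
  qed (simp add: L_def)
  define E where "E = n ` {..<N}"
  have EL: "m \<le> L" if "m \<in> E" for m using that nL by (auto simp: E_def)
  have LE: "L \<in> E" using assms(1) by (auto simp: E_def L_def)
  define h where "h x = (\<Sum>k<N. a (n k) * x ^ n k)" for x
  define dom where "dom M K \<longleftrightarrow> (\<forall>A. real_psd N A \<longrightarrow> entries_between N A \<rho> \<longrightarrow>
      real_psd N (\<lambda>i j. K * h (A i j) - A i j ^ M))" for M K
  have "\<exists>K. dom M K" if "M > L" for M
    unfolding dom_def h_def
    by (rule power_dominated_by_lower_powers[OF mono _ a \<rho>])
       (use nL that in \<open>auto intro: le_less_trans\<close>)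
  then obtain K where K: "\<And>M. M > L \<Longrightarrow> dom M (K M)" by metis
  \<comment> \<open>The factor \<open>1 + \<bar>K M\<bar>\<close> keeps the total loss within one copy of \<open>h\<close>, \<open>(1 + \<rho>) ^ M\<close> ensures
    convergence on \<open>(0, \<rho>)\<close>, and \<open>2 ^ Suc M\<close> makes both estimates summable with sum \<open>1\<close>.\<close>
  define \<delta> where "\<delta> M = 1 / ((1 + \<bar>K M\<bar>) * 2 ^ Suc M * (1 + \<rho>) ^ M)" for M
  have \<delta>pos: "\<delta> M > 0" for M using \<rho> by (simp add: \<delta>_def add_pos_nonneg)
  have \<delta>K: "\<delta> M * \<bar>K M\<bar> \<le> (1/2) ^ Suc M" for M
  proof -
    have "\<delta> M * \<bar>K M\<bar> = (\<bar>K M\<bar> / (1 + \<bar>K M\<bar>)) * (1 / (1 + \<rho>) ^ M) * (1/2) ^ Suc M"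
      by (simp add: \<delta>_def power_divide)
    also have "\<dots> \<le> 1 * 1 * (1/2) ^ Suc M"
      using \<rho> by (intro mult_right_mono mult_mono) (auto simp: divide_le_eq add_pos_nonneg)
    finally show ?thesis by simp
  qed
  have \<delta>x: "\<delta> M * x ^ M \<le> (1/2) ^ Suc M" if "0 < x" "x < \<rho>" for M x
  proof -
    have "\<delta> M * x ^ M = (1 / (1 + \<bar>K M\<bar>)) * (x ^ M / (1 + \<rho>) ^ M) * (1/2) ^ Suc M"
      by (simp add: \<delta>_def power_divide)
    also have "\<dots> \<le> 1 * 1 * (1/2) ^ Suc M"
      using \<rho> that by (intro mult_right_mono mult_mono) (auto simp: divide_le_eq intro!: power_mono)
    finally show ?thesis by simp
  qed
  define c where "c m = (if m \<in> E then a m else if m < L then 0 else of_int (\<epsilon> m) * \<delta> m)" for m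
  have c_low: "c m = (if m \<in> E then a m else 0)" if "m \<le> L" for m
    using that LE by (auto simp: c_def)
  have c_high: "c m = of_int (\<epsilon> m) * \<delta> m" if "m > L" for m
    using that EL[of m] by (auto simp: c_def)
  have c_abs: "\<bar>c m\<bar> \<le> \<delta> m" if "m > L" for m
    using sign[of m] that \<delta>pos[of m] by (auto simp: c_high L_def abs_mult)
  define g where "g x = (\<Sum>m. c m * x ^ m)" for x
  have g_sums: "(\<lambda>m. c m * x ^ m) sums g x" if x: "0 < x" "x < \<rho>" for x
  proof -
    have "summable (\<lambda>m. c m * x ^ m)"
    proof (rule summable_comparison_test')
      show "summable (\<lambda>m. (1/2::real) ^ Suc m)" using power_half_series sums_summable by blast
      fix m assume m: "Suc L \<le> m"
      have "norm (c m * x ^ m) = \<bar>c m\<bar> * x ^ m" using x by (simp add: abs_mult)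
      also have "\<dots> \<le> \<delta> m * x ^ m" using c_abs[of m] m x by (intro mult_right_mono) auto
      also have "\<dots> \<le> (1/2) ^ Suc m" by (rule \<delta>x[OF x])
      finally show "norm (c m * x ^ m) \<le> (1/2) ^ Suc m" .
    qed
    then show ?thesis unfolding g_def by (rule summable_sums)
  qed
  have g_psd: "real_psd N (\<lambda>i j. g (A i j))" if A: "real_psd N A" "entries_between N A \<rho>" for A
  proof -
    have "0 \<le> quad_form N (\<lambda>i j. g (A i j)) x" for x
    proof -
      define Q where "Q m = quad_form N (\<lambda>i j. A i j ^ m) x" for m
      define H where "H = quad_form N (\<lambda>i j. h (A i j)) x"
      have Q0: "0 \<le> Q m" for m unfolding Q_def by (intro real_psd_nonneg real_psd_power A)
      have H_eq: "H = (\<Sum>k<N. a (n k) * Q (n k))"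
        unfolding H_def h_def quad_form_sum quad_form_scale Q_def ..
      have H0: "0 \<le> H" unfolding H_eq using a Q0 by (intro sum_nonneg) (auto simp: less_imp_le)
      have QH: "Q M \<le> K M * H" if "M > L" for M
      proof -
        have "real_psd N (\<lambda>i j. K M * h (A i j) - A i j ^ M)"
          using K[OF that] A unfolding dom_def by blast
        from real_psd_nonneg[OF this, of x] show ?thesis
          by (simp add: quad_form_diff quad_form_scale Q_def H_def)
      qed
      have g_form: "(\<lambda>m. c m * Q m) sums quad_form N (\<lambda>i j. g (A i j)) x"
      proof -
        have "(\<lambda>m. \<Sum>i<N. \<Sum>j<N. c m * A i j ^ m * x i * x j) sums quad_form N (\<lambda>i j. g (A i j)) x"
          unfolding quad_form_def using A(2) by (intro sums_sum sums_mult2 g_sums) auto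
        then show ?thesis by (simp add: Q_def quad_form_def sum_distrib_left mult.assoc)
      qed
      have h_form: "(\<lambda>m. if m \<in> E then a m * Q m else 0) sums H"
      proof -
        have "inj_on n {..<N}" using mono by (rule strict_mono_on_imp_inj_on)
        then have "(\<Sum>m\<in>E. a m * Q m) = H" by (simp add: E_def H_eq sum.reindex)
        then show ?thesis using sums_If_finite_set[of E "\<lambda>m. a m * Q m"] by (simp add: E_def)
      qed
      \<comment> \<open>Adding \<open>(1/2) ^ Suc m * H\<close> to the \<open>m\<close>-th term adds \<open>H\<close> in total and makes every term
        at least the corresponding term of the series for \<open>H\<close>.\<close>
      have sums: "(\<lambda>m. c m * Q m + (1/2) ^ Suc m * H) sums (quad_form N (\<lambda>i j. g (A i j)) x + 1 * H)"
        by (intro sums_add g_form sums_mult2 power_half_series)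
      have le: "(if m \<in> E then a m * Q m else 0) \<le> c m * Q m + (1/2) ^ Suc m * H" for m
      proof (cases "m \<le> L")
        case True
        then show ?thesis using H0 by (simp add: c_low)
      next
        case False
        then have m: "m > L" by simp
        have "- (c m * Q m) \<le> \<bar>c m\<bar> * Q m" using Q0[of m] by (metis abs_ge_minus_self minus_mult_left mult_right_mono)
        also have "\<dots> \<le> \<delta> m * (\<bar>K m\<bar> * H)"
        proof (intro mult_mono c_abs m Q0)
          have "K m * H \<le> \<bar>K m\<bar> * H" using H0 by (intro mult_right_mono) auto
          then show "Q m \<le> \<bar>K m\<bar> * H" using QH[OF m] by simp
        qed (use \<delta>pos[of m] in simp)
        also have "\<dots> \<le> (1/2) ^ Suc m * H"
          using mult_right_mono[OF \<delta>K[of m] H0] by (simp add: mult.assoc)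
        finally have "0 \<le> c m * Q m + (1/2) ^ Suc m * H" by simp
        moreover have "m \<notin> E" using EL[of m] m by auto
        ultimately show ?thesis by simp
      qed
      from sums_le[OF le h_form sums] show ?thesis by simp
    qed
    then show ?thesis using real_psd_sym[OF A(1)] by (simp add: real_psd_def)
  qed
  show ?thesis
  proof (intro exI[of _ "\<lambda>z. complex_of_real (g (Re z))"] exI[of _ c] conjI allI ballI impI)
    show "c (n j) = a (n j)" if "j < N" for j using that by (auto simp: c_def E_def)
    show "c m = 0" if "m < n (N - 1)" "m \<notin> n ` {..<N}" for m
      using that c_low[of m] by (simp add: L_def E_def)
    show "(\<lambda>m. complex_of_real (c m) * x ^ m) sums complex_of_real (g (Re x))"
      if x: "x \<in> complex_of_real ` {0<..<\<rho>}" for x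
    proof -
      obtain y where y: "x = complex_of_real y" "0 < y" "y < \<rho>" using x by auto
      then have "(\<lambda>m. complex_of_real (c m * y ^ m)) sums complex_of_real (g y)"
        using g_sums[of y] by (simp only: sums_of_real_iff)
      then show ?thesis by (simp add: y)
    qed
    show "entrywise_positivity_preserver (\<lambda>z. complex_of_real (g (Re z))) N (complex_of_real ` {0<..<\<rho>})"
      by (rule entrywise_positivity_preserver_of_real[where g = g]) (rule g_psd)
    show "sgn (c M) = of_int (\<epsilon> M)" if "M > n (N - 1)" for M
    proof -
      have "sgn (c M) = sgn (of_int (\<epsilon> M))"
        using that \<delta>pos[of M] by (simp add: c_high L_def sgn_mult)
      then show ?thesis using sign[OF that] by auto
    qed
  qed
qed

end
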